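(* Let $A\subset\mathbb{R}$ be an open invex subset with respect to $\eta:A\times A\to\mathbb{R}$ and let $a,b\in A$ with $a<a+\eta(b,a)$. Suppose that $f:A\to\mathbb{R}$ is a differentiable function such that $|f'|^{q}$ is preinvex with respect to $\eta$ on $[a,a+\eta(b,a)]$ for some fixed $q>1$, that $f'$ is integrable on $[a,a+\eta(b,a)]$, and that $\eta$ satisfies condition C. Let $\frac1p+\frac1q=1$. Then $$\left|f\left(\frac{2a+\eta(b,a)}{2}\right)-\frac{1}{\eta(b,a)}\int_{a}^{a+\eta(b,a)}f(u)\,du\right|\le\left(\frac{1}{p+1}\right)^{\frac1p}\left\{\frac{\eta(b,a)}{4}\left(\frac{3|f'(a)|^{q}+|f'(a+\eta(b,a))|^{q}}{4}\right)^{\frac1q}+\frac{\eta(b,a)}{4}\left(\frac{3|f'(a+\eta(b,a))|^{q}+|f'(a)|^{q}}{4}\right)^{\frac1q}\right\}.$$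
   Context: A set $A\subset\mathbb{R}$ is called invex with respect to $\eta:A\times A\to\mathbb{R}$ if $x+t\eta(y,x)\in A$ for all $x,y\in A$ and $t\in[0,1]$. A function $g$ is called preinvex with respect to $\eta$ on a set $S\subset A$ that is invex with respect to $\eta$ if $g(x+t\eta(y,x))\le(1-t)g(x)+t\,g(y)$ for all $x,y\in S$ and $t\in[0,1]$. Condition C on $\eta$ (for $A$ open and invex with respect to $\eta$): for any $x,y\in A$ and any $t\in[0,1]$, $\eta(y,y+t\eta(x,y))=-t\,\eta(x,y)$ and $\eta(x,y+t\eta(x,y))=(1-t)\,\eta(x,y)$. Under condition C one has $\eta(y+t_2\eta(x,y),y+t_1\eta(x,y))=(t_2-t_1)\eta(x,y)$ for $x,y\in A$, $t_1,t_2\in[0,1]$, so the interval $[a,a+\eta(b,a)]$ is invex with respect to $\eta$. *)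

theory Defs
  imports "HOL-Analysis.Analysis"
begin

text \<open>The map \<open>\<eta> : A \<times> A \<rightarrow> \<real>\<close> is modelled by a curried total function; only its values at
  arguments in \<open>A\<close> enter the notions below.\<close>

definition invex :: "real set \<Rightarrow> (real \<Rightarrow> real \<Rightarrow> real) \<Rightarrow> bool" where
  "invex A \<eta> \<longleftrightarrow> (\<forall>x\<in>A. \<forall>y\<in>A. \<forall>t\<in>{0..1}. x + t * \<eta> y x \<in> A)"

text \<open>As for \<^const>\<open>convex_on\<close>, invexity of the domain is part of the notion.\<close>

definition preinvex_on :: "real set \<Rightarrow> (real \<Rightarrow> real \<Rightarrow> real) \<Rightarrow> (real \<Rightarrow> real) \<Rightarrow> bool" where
  "preinvex_on S \<eta> g \<longleftrightarrow> invex S \<eta> \<and>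
     (\<forall>x\<in>S. \<forall>y\<in>S. \<forall>t\<in>{0..1}. g (x + t * \<eta> y x) \<le> (1 - t) * g x + t * g y)"

definition condition_C :: "real set \<Rightarrow> (real \<Rightarrow> real \<Rightarrow> real) \<Rightarrow> bool" where
  "condition_C A \<eta> \<longleftrightarrow> (\<forall>x\<in>A. \<forall>y\<in>A. \<forall>t\<in>{0..1}.
     \<eta> y (y + t * \<eta> x y) = - t * \<eta> x y \<and>
     \<eta> x (y + t * \<eta> x y) = (1 - t) * \<eta> x y)"

end

theory Submission
  imports Defs
begin

text \<open>With \<open>L = \<eta> b a\<close> and \<open>c = a + L\<close>, condition C gives \<open>\<eta> c a = L\<close>, so that
  preinvexity bounds \<open>\<bar>f'\<bar> powr q\<close> on \<open>[a, c]\<close> by the chord through its end values. Integrating by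
  parts on either half of \<open>[a, c]\<close>, with the weight that measures the distance to the end point
  \<open>a\<close> or \<open>c\<close>, expresses the deviation of the midpoint value from the mean as two integrals of
  \<open>f'\<close>, each of which is estimated by Hoelder's inequality.\<close>

text \<open>Integrate Young's inequality for the normalised functions \<open>P / U\<close> and
  \<open>Q / V\<close>. Asking only for pointwise domination of \<open>g\<close> lets
  \<open>Q\<close> be a convenient majorant of a power, here a linear one.\<close>

lemma Holder_has_integral:
  fixes g P Q :: "'a::euclidean_space \<Rightarrow> real"
  assumes pq: "p > 1" "q > 1" "1 / p + 1 / q = 1"
    and int: "(g has_integral I) S" "(P has_integral U) S" "(Q has_integral V) S"
    and nonneg: "\<And>x. x \<in> S \<Longrightarrow> 0 \<le> P x" "\<And>x. x \<in> S \<Longrightarrow> 0 \<le> Q x"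
    and le: "\<And>x. x \<in> S \<Longrightarrow> \<bar>g x\<bar> \<le> P x powr (1 / p) * Q x powr (1 / q)"
  shows "\<bar>I\<bar> \<le> U powr (1 / p) * V powr (1 / q)"
proof -
  have "0 \<le> U" "0 \<le> V"
    using has_integral_nonneg int nonneg by blast+
  \<comment> \<open>\<open>U\<close> or \<open>V\<close> may vanish, so the normalisers are shifted
    by \<open>e\<close> to be positive; the shift is removed at the end by letting \<open>e\<close>
    tend to 0 from the right.\<close>
  have bound: "\<bar>I\<bar> \<le> (U + e) powr (1 / p) * (V + e) powr (1 / q)" if "e > 0" for e
  proof -
    define u v where "u = U + e" and "v = V + e"
    have pos: "u > 0" "v > 0" and uv: "U \<le> u" "V \<le> v"
      using \<open>0 \<le> U\<close> \<open>0 \<le> V\<close> \<open>e > 0\<close> by (auto simp: u_def v_def)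
    define c where "c = u powr (1 / p) * v powr (1 / q)"
    have "c > 0"
      using pos by (simp add: c_def)
    have *: "\<bar>g x\<bar> \<le> c * (P x / u / p + Q x / v / q)" if "x \<in> S" for x
    proof -
      have "(P x / u) powr (1 / p) * (Q x / v) powr (1 / q) \<le> P x / u / p + Q x / v / q"
        using Youngs_inequality[OF pq, of "(P x / u) powr (1 / p)" "(Q x / v) powr (1 / q)"]
          nonneg[OF that] pos pq by (simp add: powr_powr)
      moreover have "P x powr (1 / p) * Q x powr (1 / q)
          = c * ((P x / u) powr (1 / p) * (Q x / v) powr (1 / q))"
        using nonneg[OF that] pos by (simp add: c_def powr_divide)
      ultimately show ?thesis
        using le[OF that] \<open>c > 0\<close> by (smt (verit) mult_left_mono)
    qed
    have J: "((\<lambda>x. c * (P x / u / p + Q x / v / q)) has_integral c * (U / u / p + V / v / q)) S"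
      by (intro has_integral_mult_right has_integral_add has_integral_divide int)
    have "I \<le> c * (U / u / p + V / v / q)"
      by (rule has_integral_le[OF int(1) J]) (use * in \<open>simp add: abs_le_iff\<close>)
    moreover have "- I \<le> c * (U / u / p + V / v / q)"
      by (rule has_integral_le[OF has_integral_neg[OF int(1)] J]) (use * in \<open>simp add: abs_le_iff\<close>)
    moreover have "U / u / p + V / v / q \<le> 1 / p + 1 / q"
      using pq pos uv by (intro add_mono divide_right_mono) auto
    then have "c * (U / u / p + V / v / q) \<le> c"
      using pq \<open>c > 0\<close> by simp
    ultimately show ?thesis
      by (simp add: c_def u_def v_def)
  qed
  \<comment> \<open>A base may tend to 0 here; \<open>powr\<close> still passes to the limit because
    the exponents are positive and the bases are nonnegative near the limit.\<close>
  have "((\<lambda>e. (U + e) powr (1 / p) * (V + e) powr (1 / q)) \<longlongrightarrow>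
      (U + 0) powr (1 / p) * (V + 0) powr (1 / q)) (at_right 0)"
    using pq \<open>0 \<le> U\<close> \<open>0 \<le> V\<close>
    by (intro tendsto_mult tendsto_powr' tendsto_add tendsto_const tendsto_ident_at disjI2 conjI)
      (auto simp: eventually_at_right_less intro!: eventually_mono[OF eventually_at_right_less])
  then show ?thesis
    using bound by (intro tendsto_lowerbound[where F = "at_right (0::real)"])
      (auto intro!: eventually_mono[OF eventually_at_right_less])
qed

text \<open>The weight \<open>s\<close> vanishes at 0, so integrating the product rule for
  \<open>s * f s\<close> leaves only the boundary term at \<open>h\<close>. Hoelder's inequality
  then pairs \<open>s powr p\<close> with the linear majorant, whose mean over \<open>{0..h}\<close>
  is its value at \<open>h / 2\<close>.\<close>

lemma endpoint_minus_integral_le: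
  fixes f f' :: "real \<Rightarrow> real"
  assumes pq: "p > 1" "q > 1" "1 / p + 1 / q = 1" and "h > 0"
    and deriv: "\<And>s. s \<in> {0..h} \<Longrightarrow> (f has_real_derivative f' s) (at s within {0..h})"
    and le: "\<And>s. s \<in> {0..h} \<Longrightarrow> \<bar>f' s\<bar> powr q \<le> A + B * s"
  shows "\<bar>h * f h - integral {0..h} f\<bar>
    \<le> h\<^sup>2 * ((1 / (p + 1)) powr (1 / p) * (A + B * h / 2) powr (1 / q))"
proof -
  have "continuous_on {0..h} f"
    using deriv DERIV_continuous_on by blast
  then have intf: "(f has_integral integral {0..h} f) {0..h}"
    using integrable_continuous_real by blast
  have "((\<lambda>s. s * f' s + f s) has_integral (h * f h - 0 * f 0)) {0..h}"
    using \<open>h > 0\<close> deriv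
    by (intro fundamental_theorem_of_calculus)
      (auto simp flip: has_real_derivative_iff_has_vector_derivative
        intro!: derivative_eq_intros)
  from has_integral_diff[OF this intf]
  have I: "((\<lambda>s. s * f' s) has_integral (h * f h - integral {0..h} f)) {0..h}"
    by simp
  have P: "((\<lambda>s. s powr p) has_integral h powr (p + 1) / (p + 1)) {0..h}"
    using has_integral_powr_from_0[of p h] pq \<open>h > 0\<close> by simp
  have "((\<lambda>s. A + B * s) has_integral ((A * h + B * h\<^sup>2 / 2) - (A * 0 + B * 0\<^sup>2 / 2))) {0..h}"
    using \<open>h > 0\<close>
    by (intro fundamental_theorem_of_calculus)
      (auto simp flip: has_real_derivative_iff_has_vector_derivative
        intro!: derivative_eq_intros)
  then have Q: "((\<lambda>s. A + B * s) has_integral (h * (A + B * h / 2))) {0..h}"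
    by (simp add: algebra_simps power2_eq_square)
  have Q0: "0 \<le> A + B * s" if "s \<in> {0..h}" for s
    using le[OF that] powr_ge_zero order_trans by blast
  have "\<bar>s * f' s\<bar> \<le> (s powr p) powr (1 / p) * (A + B * s) powr (1 / q)" if "s \<in> {0..h}" for s
  proof -
    have "\<bar>f' s\<bar> = (\<bar>f' s\<bar> powr q) powr (1 / q)"
      using pq by (simp add: powr_powr)
    also have "\<dots> \<le> (A + B * s) powr (1 / q)"
      using le[OF that] pq by (intro powr_mono2) auto
    finally show ?thesis
      using that pq by (auto simp: powr_powr abs_mult intro!: mult_left_mono)
  qed
  then have "\<bar>h * f h - integral {0..h} f\<bar>
      \<le> (h powr (p + 1) / (p + 1)) powr (1 / p) * (h * (A + B * h / 2)) powr (1 / q)"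
    by (intro Holder_has_integral[OF pq I P Q]) (use Q0 in auto)
  also have "\<dots> = (h powr ((p + 1) / p) * h powr (1 / q)) *
      ((1 / (p + 1)) powr (1 / p) * (A + B * h / 2) powr (1 / q))"
  \<comment> \<open>Nonnegativity of the second base, read off from the majorant at
    \<open>s = h / 2\<close>, lets the powers split.\<close>
  proof -
    have "0 \<le> A + B * h / 2"
      using Q0[of "h / 2"] \<open>h > 0\<close> by simp
    then show ?thesis
      using \<open>h > 0\<close> pq by (simp add: powr_divide powr_mult powr_powr)
  qed
  also have "h powr ((p + 1) / p) * h powr (1 / q) = h powr 2"
  proof -
    have "(p + 1) / p + 1 / q = 2"
      using pq by (simp add: add_divide_distrib)
    then show ?thesis
      by (simp flip: powr_add)
  qed
  finally show ?thesis
    using \<open>h > 0\<close> by (simp add: powr_numeral)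
qed

text \<open>The first identity of condition C at \<open>t = 1\<close> reverses a path. With
  \<open>c = a + \<eta> b a\<close>, it gives \<open>\<eta> a c = - \<eta> b a\<close>; hence
  \<open>c + \<eta> a c = a\<close>, and reversing once more gives
  \<open>\<eta> c a = - \<eta> a c\<close>.\<close>

lemma condition_C_eta_endpoint:
  assumes C: "condition_C A \<eta>" and "invex A \<eta>" and "a \<in> A" "b \<in> A"
  shows "\<eta> (a + \<eta> b a) a = \<eta> b a"
proof -
  have c: "a + \<eta> b a \<in> A"
    using assms unfolding invex_def by (force dest: bspec[where x = 1])
  have *: "\<eta> y (y + \<eta> x y) = - \<eta> x y" if "x \<in> A" "y \<in> A" for x y
    using C that unfolding condition_C_def by (force dest: bspec[where x = 1])
  show ?thesis
    using *[OF \<open>b \<in> A\<close> \<open>a \<in> A\<close>] *[OF \<open>a \<in> A\<close> c] by simp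
qed

theorem corollary2p6:
  fixes A :: "real set" and \<eta> :: "real \<Rightarrow> real \<Rightarrow> real"
    and f f' :: "real \<Rightarrow> real" and a b p q :: real
  assumes "open A" and "invex A \<eta>"
    and "a \<in> A" and "b \<in> A" and "a < a + \<eta> b a"
    and "\<And>x. x \<in> A \<Longrightarrow> (f has_real_derivative f' x) (at x)"
    and "q > 1"
    and "preinvex_on {a..a + \<eta> b a} \<eta> (\<lambda>x. \<bar>f' x\<bar> powr q)"
    and "f' absolutely_integrable_on {a..a + \<eta> b a}"
    and "condition_C A \<eta>"
    and "1 / p + 1 / q = 1"
  shows "\<bar>f ((2 * a + \<eta> b a) / 2) - 1 / \<eta> b a * integral {a..a + \<eta> b a} f\<bar>
    \<le> (1 / (p + 1)) powr (1 / p) *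
      (\<eta> b a / 4 * ((3 * \<bar>f' a\<bar> powr q + \<bar>f' (a + \<eta> b a)\<bar> powr q) / 4) powr (1 / q)
       + \<eta> b a / 4 * ((3 * \<bar>f' (a + \<eta> b a)\<bar> powr q + \<bar>f' a\<bar> powr q) / 4) powr (1 / q))"
proof -
  define L c where "L = \<eta> b a" and "c = a + L"
  define g where "g x = \<bar>f' x\<bar> powr q" for x
  define K where "K = (1 / (p + 1)) powr (1 / p)"
  have "L > 0"
    using assms(5) by (simp add: L_def)
  \<comment> \<open>Conjugacy forces \<open>p > 1\<close>; the degenerate case \<open>p = 0\<close>,
    where \<open>1 / p = 0\<close> by convention, would give \<open>q = 1\<close>.\<close>
  have "1 / q > 0" "1 / q < 1"
    using assms(7) by auto
  then have "1 / p > 0" "1 / p < 1"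
    using assms(11) by linarith+
  then have "p > 1"
    by (simp add: divide_less_eq)
  then have pq: "p > 1" "q > 1" "1 / p + 1 / q = 1"
    using assms(7,11) by auto
  have inA: "a + t * L \<in> A" if "t \<in> {0..1}" for t
    using assms(2-4) that unfolding invex_def L_def by blast
  have deriv: "(f has_real_derivative f' x) (at x)" if "x \<in> {a..c}" for x
    using assms(6) inA[of "(x - a) / L"] that \<open>L > 0\<close> by (simp add: c_def field_simps)
  \<comment> \<open>Since \<open>b\<close> may lie outside \<open>{a..c}\<close>, preinvexity is
    applied to \<open>a\<close> and \<open>c\<close>; this equation makes the path
    \<open>a + t * \<eta> c a\<close> sweep exactly \<open>{a..c}\<close>.\<close>
  have "\<eta> c a = L"
    using condition_C_eta_endpoint[OF assms(10,2,3,4)] by (simp add: c_def L_def)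
  have g_le: "g (a + t * L) \<le> (1 - t) * g a + t * g c" if "t \<in> {0..1}" for t
  proof -
    have "a \<in> {a..c}" "c \<in> {a..c}"
      using \<open>L > 0\<close> by (simp_all add: c_def)
    then have "g (a + t * \<eta> c a) \<le> (1 - t) * g a + t * g c"
      using assms(8) that unfolding preinvex_on_def c_def L_def g_def by blast
    then show ?thesis
      using \<open>\<eta> c a = L\<close> by simp
  qed
  have g_chord: "g x \<le> g a + (g c - g a) / L * (x - a)" if "x \<in> {a..c}" for x
  proof -
    have "g x \<le> (1 - (x - a) / L) * g a + (x - a) / L * g c"
      using g_le[of "(x - a) / L"] that \<open>L > 0\<close> by (simp add: c_def)
    also have "\<dots> = g a + (g c - g a) / L * (x - a)"
      by (simp add: algebra_simps diff_divide_distrib)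
    finally show ?thesis .
  qed

  define h where "h = L / 2"
  have "h > 0" "c = a + 2 * h" "L = 2 * h"
    using \<open>L > 0\<close> by (auto simp: h_def c_def)
  have left: "\<bar>h * f (a + h) - integral {0..h} (\<lambda>s. f (a + s))\<bar>
      \<le> h\<^sup>2 * (K * (g a + (g c - g a) / L * h / 2) powr (1 / q))"
    unfolding K_def
  proof (rule endpoint_minus_integral_le[OF pq \<open>h > 0\<close>])
    fix s assume s: "s \<in> {0..h}"
    show "((\<lambda>s. f (a + s)) has_real_derivative f' (a + s)) (at s within {0..h})"
    proof -
      have "((\<lambda>s. a + s) has_real_derivative 1) (at s within {0..h})"
        by (auto intro!: derivative_eq_intros)
      moreover have "(f has_real_derivative f' (a + s)) (at (a + s))"
        using deriv[of "a + s"] s \<open>c = a + 2 * h\<close> by simp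
      ultimately show ?thesis
        using DERIV_chain2 by fastforce
    qed
    show "\<bar>f' (a + s)\<bar> powr q \<le> g a + (g c - g a) / L * s"
      using g_chord[of "a + s"] s \<open>c = a + 2 * h\<close> by (simp add: g_def)
  qed
  \<comment> \<open>The reflection \<open>c - s\<close> puts the zero of the weight at
    \<open>c\<close> and exchanges \<open>g a\<close> and \<open>g c\<close>; the sign of the
    derivative is absorbed by the absolute value.\<close>
  have right: "\<bar>h * f (c - h) - integral {0..h} (\<lambda>s. f (c - s))\<bar>
      \<le> h\<^sup>2 * (K * (g c + (g a - g c) / L * h / 2) powr (1 / q))"
    unfolding K_def
  proof (rule endpoint_minus_integral_le[OF pq \<open>h > 0\<close>])
    fix s assume s: "s \<in> {0..h}"
    show "((\<lambda>s. f (c - s)) has_real_derivative - f' (c - s)) (at s within {0..h})"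
    proof -
      have "((\<lambda>s. c - s) has_real_derivative - 1) (at s within {0..h})"
        by (auto intro!: derivative_eq_intros)
      moreover have "(f has_real_derivative f' (c - s)) (at (c - s))"
        using deriv[of "c - s"] s \<open>c = a + 2 * h\<close> by simp
      ultimately show ?thesis
        using DERIV_chain2 by fastforce
    qed
    show "\<bar>- f' (c - s)\<bar> powr q \<le> g c + (g a - g c) / L * s"
      using g_chord[of "c - s"] s \<open>c = a + 2 * h\<close> \<open>L = 2 * h\<close> \<open>h > 0\<close>
      by (simp add: g_def field_simps)
  qed

  have intf: "f integrable_on {a..c}"
    using deriv by (intro integrable_continuous_real DERIV_continuous_on[where D = f'])
      (rule has_field_derivative_at_within)
  have il: "integral {0..h} (\<lambda>s. f (a + s)) = integral {a..a + h} f"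
    using integral_shift_real_ivl[of a a "a + h" f] by (simp add: add.commute)
  \<comment> \<open>The substitution is split into a reflection about 0 and a translation by
    \<open>c\<close>.\<close>
  have ir: "integral {0..h} (\<lambda>s. f (c - s)) = integral {a + h..c} f"
    using integral_shift_real_ivl[of "-c" "-c" "-(a + h)" "\<lambda>x. f (- x)"]
      Henstock_Kurzweil_Integration.integral_reflect_real[of c "a + h" f] \<open>c = a + 2 * h\<close>
    by (simp add: algebra_simps)
  have ic: "integral {a..a + h} f + integral {a + h..c} f = integral {a..c} f"
    using \<open>h > 0\<close> \<open>c = a + 2 * h\<close> intf by (intro Henstock_Kurzweil_Integration.integral_combine) auto
  \<comment> \<open>Both halves have their far end at the midpoint \<open>a + h\<close>, so the two
    boundary terms add up to \<open>L * f (a + h)\<close>.\<close>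
  have mid: "c - h = a + h" "L * f (a + h) = h * f (a + h) + h * f (a + h)"
    using \<open>c = a + 2 * h\<close> \<open>L = 2 * h\<close> by simp_all
  have "\<bar>L * f (a + h) - integral {a..c} f\<bar>
      \<le> h\<^sup>2 * (K * (g a + (g c - g a) / L * h / 2) powr (1 / q))
        + h\<^sup>2 * (K * (g c + (g a - g c) / L * h / 2) powr (1 / q))"
    using left right unfolding il ir mid ic[symmetric] by linarith
  \<comment> \<open>The mean of the chord over a half interval is its value at a quarter point, as
    \<open>h / 2 = L / 4\<close>: hence the weights 3/4 and 1/4.\<close>
  also have "g a + (g c - g a) / L * h / 2 = (3 * g a + g c) / 4"
    using \<open>h > 0\<close> unfolding \<open>L = 2 * h\<close> by (simp add: field_simps)
  also have "g c + (g a - g c) / L * h / 2 = (3 * g c + g a) / 4"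
    using \<open>h > 0\<close> unfolding \<open>L = 2 * h\<close> by (simp add: field_simps)
  \<comment> \<open>Here \<open>h\<^sup>2 = L / 4 * L\<close>; the outer factor \<open>L\<close> is
    set apart to cancel in the division that turns the integral into a mean.\<close>
  also have "h\<^sup>2 * (K * X) + h\<^sup>2 * (K * Y) = K * (L / 4 * X + L / 4 * Y) * L" for X Y
    by (simp add: h_def power2_eq_square algebra_simps)
  finally have "\<bar>L * f (a + h) - integral {a..c} f\<bar> / L
      \<le> K * (L / 4 * ((3 * g a + g c) / 4) powr (1 / q)
        + L / 4 * ((3 * g c + g a) / 4) powr (1 / q))"
    by (simp only: pos_divide_le_eq[OF \<open>L > 0\<close>])
  moreover have "\<bar>L * f (a + h) - integral {a..c} f\<bar> / L
      = \<bar>f ((2 * a + L) / 2) - 1 / L * integral {a..c} f\<bar>"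
  proof -
    have centre: "(2 * a + L) / 2 = a + h"
      by (simp add: h_def)
    have "f (a + h) - 1 / L * integral {a..c} f = (L * f (a + h) - integral {a..c} f) / L"
      using \<open>L > 0\<close> by (simp add: diff_divide_distrib)
    then show ?thesis
      unfolding centre using \<open>L > 0\<close> by (simp only: abs_divide abs_of_pos)
  qed
  ultimately show ?thesis
    by (simp add: K_def g_def c_def L_def)
qed

end
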